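(* Let $\mathcal{C}$ and $\mathcal{X}$ be categories with finite limits and finite colimits, and let $F:\mathcal{C}\to\mathcal{X}$ be a weak opfibration that preserves and reflects monomorphisms. Then a morphism $m$ in $\mathcal{C}$ is an essential monomorphism if and only if the morphism $F(m)$ is an essential monomorphism in $\mathcal{X}$.
   Context: A monomorphism $m:S\to A$ in a category is an essential monomorphism if every morphism $f:A\to B$ for which $fm$ is a monomorphism is itself a monomorphism. A functor $F:\mathcal{C}\to\mathcal{X}$ is a weak opfibration if, for every object $C$ in $\mathcal{C}$ and every morphism $v:F(C)\to Y$ in $\mathcal{X}$, there exist a morphism $g:C\to V$ in $\mathcal{C}$ and a monomorphism $\psi:Y\to F(V)$ in $\mathcal{X}$ with $F(g)=\psi v$. *)

theory Defs
  imports Main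
begin

text \<open>A category has one set of objects and one set of arrows. Composition is total on the
  arrow type but is only meaningful for composable arrows of the carrier; \<open>g \<cdot>\<^bsub>C\<^esub> f\<close> means
  ``first \<open>f\<close>, then \<open>g\<close>''.\<close>

record ('o, 'a) cat =
  Obj :: "'o set"
  Arr :: "'a set"
  Dom :: "'a \<Rightarrow> 'o"
  Cod :: "'a \<Rightarrow> 'o"
  Ident :: "'o \<Rightarrow> 'a"
  Comp :: "'a \<Rightarrow> 'a \<Rightarrow> 'a" (infixr "\<cdot>\<index>" 70)

definition in_hom :: "('o, 'a) cat \<Rightarrow> 'a \<Rightarrow> 'o \<Rightarrow> 'o \<Rightarrow> bool" where
  "in_hom C f A B \<longleftrightarrow> f \<in> Arr C \<and> Dom C f = A \<and> Cod C f = B"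

locale category =
  fixes C :: "('o, 'a) cat" (structure)
  assumes Dom_Obj: "f \<in> Arr C \<Longrightarrow> Dom C f \<in> Obj C"
    and Cod_Obj: "f \<in> Arr C \<Longrightarrow> Cod C f \<in> Obj C"
    and Ident_in_hom: "A \<in> Obj C \<Longrightarrow> in_hom C (Ident C A) A A"
    and Comp_in_hom: "\<lbrakk>in_hom C f A B; in_hom C g B D\<rbrakk> \<Longrightarrow> in_hom C (g \<cdot> f) A D"
    and Comp_Ident: "in_hom C f A B \<Longrightarrow> f \<cdot> Ident C A = f"
    and Ident_Comp: "in_hom C f A B \<Longrightarrow> Ident C B \<cdot> f = f"
    and Comp_assoc: "\<lbrakk>in_hom C f A B; in_hom C g B D; in_hom C h D E\<rbrakk>
                      \<Longrightarrow> (h \<cdot> g) \<cdot> f = h \<cdot> (g \<cdot> f)"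

record ('o, 'a, 'p, 'b) cat_map =
  on_Obj :: "'o \<Rightarrow> 'p"
  on_Arr :: "'a \<Rightarrow> 'b"

locale cat_functor = C: category C + X: category X
  for C :: "('o, 'a) cat" and X :: "('p, 'b) cat" +
  fixes F :: "('o, 'a, 'p, 'b) cat_map"
  assumes on_Obj_Obj: "A \<in> Obj C \<Longrightarrow> on_Obj F A \<in> Obj X"
    and on_Arr_in_hom: "in_hom C f A B \<Longrightarrow> in_hom X (on_Arr F f) (on_Obj F A) (on_Obj F B)"
    and on_Arr_Ident: "A \<in> Obj C \<Longrightarrow> on_Arr F (Ident C A) = Ident X (on_Obj F A)"
    and on_Arr_Comp: "\<lbrakk>in_hom C f A B; in_hom C g B D\<rbrakk>
                       \<Longrightarrow> on_Arr F (g \<cdot>\<^bsub>C\<^esub> f) = on_Arr F g \<cdot>\<^bsub>X\<^esub> on_Arr F f"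

definition is_cone ::
  "('i, 'u) cat \<Rightarrow> ('o, 'a) cat \<Rightarrow> ('i, 'u, 'o, 'a) cat_map \<Rightarrow> 'o \<Rightarrow> ('i \<Rightarrow> 'a) \<Rightarrow> bool" where
  "is_cone J C D L p \<longleftrightarrow> L \<in> Obj C \<and>
     (\<forall>j \<in> Obj J. in_hom C (p j) L (on_Obj D j)) \<and>
     (\<forall>u \<in> Arr J. on_Arr D u \<cdot>\<^bsub>C\<^esub> p (Dom J u) = p (Cod J u))"

definition is_limit ::
  "('i, 'u) cat \<Rightarrow> ('o, 'a) cat \<Rightarrow> ('i, 'u, 'o, 'a) cat_map \<Rightarrow> 'o \<Rightarrow> ('i \<Rightarrow> 'a) \<Rightarrow> bool" where
  "is_limit J C D L p \<longleftrightarrow> is_cone J C D L p \<and>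
     (\<forall>M q. is_cone J C D M q \<longrightarrow>
        (\<exists>!h. in_hom C h M L \<and> (\<forall>j \<in> Obj J. p j \<cdot>\<^bsub>C\<^esub> h = q j)))"

definition is_cocone ::
  "('i, 'u) cat \<Rightarrow> ('o, 'a) cat \<Rightarrow> ('i, 'u, 'o, 'a) cat_map \<Rightarrow> 'o \<Rightarrow> ('i \<Rightarrow> 'a) \<Rightarrow> bool" where
  "is_cocone J C D L p \<longleftrightarrow> L \<in> Obj C \<and>
     (\<forall>j \<in> Obj J. in_hom C (p j) (on_Obj D j) L) \<and>
     (\<forall>u \<in> Arr J. p (Cod J u) \<cdot>\<^bsub>C\<^esub> on_Arr D u = p (Dom J u))"

definition is_colimit ::
  "('i, 'u) cat \<Rightarrow> ('o, 'a) cat \<Rightarrow> ('i, 'u, 'o, 'a) cat_map \<Rightarrow> 'o \<Rightarrow> ('i \<Rightarrow> 'a) \<Rightarrow> bool" where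
  "is_colimit J C D L p \<longleftrightarrow> is_cocone J C D L p \<and>
     (\<forall>M q. is_cocone J C D M q \<longrightarrow>
        (\<exists>!h. in_hom C h L M \<and> (\<forall>j \<in> Obj J. h \<cdot>\<^bsub>C\<^esub> p j = q j)))"

text \<open>Every finite category is isomorphic to one whose objects and arrows are natural numbers,
  so restricting the diagram shapes to carriers in \<^typ>\<open>nat\<close> loses no finite diagram. The empty
  shape is included.\<close>

definition has_finite_limits :: "('o, 'a) cat \<Rightarrow> bool" where
  "has_finite_limits C \<longleftrightarrow>
     (\<forall>(J :: (nat, nat) cat) D. finite (Obj J) \<and> finite (Arr J) \<and> cat_functor J C D \<longrightarrow>
        (\<exists>L p. is_limit J C D L p))"

definition has_finite_colimits :: "('o, 'a) cat \<Rightarrow> bool" where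
  "has_finite_colimits C \<longleftrightarrow>
     (\<forall>(J :: (nat, nat) cat) D. finite (Obj J) \<and> finite (Arr J) \<and> cat_functor J C D \<longrightarrow>
        (\<exists>L p. is_colimit J C D L p))"

definition mono_arr :: "('o, 'a) cat \<Rightarrow> 'a \<Rightarrow> bool" where
  "mono_arr C m \<longleftrightarrow> m \<in> Arr C \<and>
     (\<forall>T f g. in_hom C f T (Dom C m) \<and> in_hom C g T (Dom C m) \<and> m \<cdot>\<^bsub>C\<^esub> f = m \<cdot>\<^bsub>C\<^esub> g
        \<longrightarrow> f = g)"

definition essential_mono :: "('o, 'a) cat \<Rightarrow> 'a \<Rightarrow> bool" where
  "essential_mono C m \<longleftrightarrow> mono_arr C m \<and>
     (\<forall>f B. in_hom C f (Cod C m) B \<and> mono_arr C (f \<cdot>\<^bsub>C\<^esub> m) \<longrightarrow> mono_arr C f)"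

definition weak_opfibration ::
  "('o, 'a) cat \<Rightarrow> ('p, 'b) cat \<Rightarrow> ('o, 'a, 'p, 'b) cat_map \<Rightarrow> bool" where
  "weak_opfibration C X F \<longleftrightarrow> cat_functor C X F \<and>
     (\<forall>A Y v. A \<in> Obj C \<and> in_hom X v (on_Obj F A) Y \<longrightarrow>
        (\<exists>V g \<psi>. in_hom C g A V \<and> in_hom X \<psi> Y (on_Obj F V) \<and> mono_arr X \<psi> \<and>
                 on_Arr F g = \<psi> \<cdot>\<^bsub>X\<^esub> v))"

definition preserves_monos ::
  "('o, 'a) cat \<Rightarrow> ('p, 'b) cat \<Rightarrow> ('o, 'a, 'p, 'b) cat_map \<Rightarrow> bool" where
  "preserves_monos C X F \<longleftrightarrow> (\<forall>m \<in> Arr C. mono_arr C m \<longrightarrow> mono_arr X (on_Arr F m))"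

definition reflects_monos ::
  "('o, 'a) cat \<Rightarrow> ('p, 'b) cat \<Rightarrow> ('o, 'a, 'p, 'b) cat_map \<Rightarrow> bool" where
  "reflects_monos C X F \<longleftrightarrow> (\<forall>m \<in> Arr C. mono_arr X (on_Arr F m) \<longrightarrow> mono_arr C m)"

end

theory Submission
  imports Defs
begin

text \<open>Essentiality is tested by morphisms out of the codomain of \<open>m\<close>, so the task
  is to move such tests between \<open>C\<close> and \<open>X\<close>. From \<open>C\<close> to
  \<open>X\<close> a test is moved by applying \<open>F\<close>, which preserves and reflects
  monomorphisms (\<open>essential_mono_if_on_Arr\<close>). Conversely, a test \<open>v\<close> out
  of \<open>F(Cod m)\<close> need not come from \<open>C\<close>, but the weak opfibration property
  supplies \<open>g\<close> in \<open>C\<close> with \<open>F(g) = \<psi> v\<close> and \<psi> mono.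
  Monos compose, and a right factor of a mono is mono, so replacing \<open>v\<close> by
  \<open>F(g)\<close> changes nothing as far as being mono is concerned
  (\<open>essential_mono_on_Arr\<close>).\<close>

context category
begin

lemma mono_arr_Comp:
  assumes "mono_arr C f" "mono_arr C g" "Dom C g = Cod C f"
  shows "mono_arr C (g \<cdot> f)"
proof -
  have f: "in_hom C f (Dom C f) (Cod C f)" and g: "in_hom C g (Cod C f) (Cod C g)"
    using assms by (simp_all add: mono_arr_def in_hom_def)
  have gf: "in_hom C (g \<cdot> f) (Dom C f) (Cod C g)"
    using Comp_in_hom[OF f g] .
  have "a = b" if a: "in_hom C a T (Dom C f)" and b: "in_hom C b T (Dom C f)"
    and eq: "(g \<cdot> f) \<cdot> a = (g \<cdot> f) \<cdot> b" for T a b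
  proof -
    have "g \<cdot> (f \<cdot> a) = g \<cdot> (f \<cdot> b)"
      using eq Comp_assoc[OF a f g] Comp_assoc[OF b f g] by simp
    then have "f \<cdot> a = f \<cdot> b"
      using assms(2,3) Comp_in_hom[OF a f] Comp_in_hom[OF b f] unfolding mono_arr_def by metis
    then show ?thesis
      using assms(1) a b unfolding mono_arr_def by metis
  qed
  then show ?thesis
    using gf unfolding mono_arr_def in_hom_def by metis
qed

lemma mono_arr_Comp_right:
  assumes f: "in_hom C f A B" and g: "in_hom C g B D" and mono: "mono_arr C (g \<cdot> f)"
  shows "mono_arr C f"
proof -
  have gf: "Dom C (g \<cdot> f) = A"
    using Comp_in_hom[OF f g] by (simp add: in_hom_def)
  have "a = b" if a: "in_hom C a T A" and b: "in_hom C b T A" and eq: "f \<cdot> a = f \<cdot> b" for T a b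
  proof -
    have "(g \<cdot> f) \<cdot> a = (g \<cdot> f) \<cdot> b"
      using eq Comp_assoc[OF a f g] Comp_assoc[OF b f g] by simp
    then show ?thesis
      using mono a b gf unfolding mono_arr_def by metis
  qed
  then show ?thesis
    using f unfolding mono_arr_def in_hom_def by metis
qed

end

text \<open>A test morphism in \<open>X\<close> is enlarged by a mono until it is the image of a
  morphism of \<open>C\<close>; there essentiality of \<open>m\<close> applies, and the enlarging
  mono is cancelled at the end.\<close>

lemma essential_mono_on_Arr:
  assumes F: "weak_opfibration C X F"
    and pres: "preserves_monos C X F" and refl: "reflects_monos C X F"
    and m: "essential_mono C m"
  shows "essential_mono X (on_Arr F m)"
proof -
  interpret cat_functor C X F
    using F by (simp add: weak_opfibration_def)
  have m_arr: "m \<in> Arr C" and m_hom: "in_hom C m (Dom C m) (Cod C m)"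
    using m by (auto simp: essential_mono_def mono_arr_def in_hom_def)
  have Fm: "in_hom X (on_Arr F m) (on_Obj F (Dom C m)) (on_Obj F (Cod C m))"
    using on_Arr_in_hom[OF m_hom] .
  have "mono_arr X v"
    if v: "in_hom X v (Cod X (on_Arr F m)) Y" and mono: "mono_arr X (v \<cdot>\<^bsub>X\<^esub> on_Arr F m)" for v Y
  proof -
    have v': "in_hom X v (on_Obj F (Cod C m)) Y"
      using v Fm by (simp add: in_hom_def)
    \<comment> \<open>The weak opfibration property, taken at the object \<open>Cod C m\<close>,
      lifts \<open>v\<close> up to the mono \<psi>; this makes \<open>g\<close> composable with
      \<open>m\<close>.\<close>
    obtain V g \<psi> where g: "in_hom C g (Cod C m) V"
      and \<psi>: "in_hom X \<psi> Y (on_Obj F V)" "mono_arr X \<psi>" and Fg: "on_Arr F g = \<psi> \<cdot>\<^bsub>X\<^esub> v"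
      using F C.Cod_Obj[OF m_arr] v' unfolding weak_opfibration_def by meson
    have "on_Arr F (g \<cdot>\<^bsub>C\<^esub> m) = \<psi> \<cdot>\<^bsub>X\<^esub> (v \<cdot>\<^bsub>X\<^esub> on_Arr F m)"
      using on_Arr_Comp[OF m_hom g] Fg X.Comp_assoc[OF Fm v' \<psi>(1)] by simp
    moreover have "mono_arr X (\<psi> \<cdot>\<^bsub>X\<^esub> (v \<cdot>\<^bsub>X\<^esub> on_Arr F m))"
      using X.mono_arr_Comp[OF mono \<psi>(2)] X.Comp_in_hom[OF Fm v'] \<psi>(1) by (simp add: in_hom_def)
    \<comment> \<open>\<open>F(g m)\<close> equals \<open>\<psi> (v F(m))\<close>, a composite of
      two monos, so reflection makes \<open>g\<close> a legitimate test for
      \<open>m\<close>.\<close>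
    ultimately have "mono_arr C (g \<cdot>\<^bsub>C\<^esub> m)"
      using refl C.Comp_in_hom[OF m_hom g] by (simp add: reflects_monos_def in_hom_def)
    then have "mono_arr C g"
      using m g unfolding essential_mono_def by blast
    then have "mono_arr X (\<psi> \<cdot>\<^bsub>X\<^esub> v)"
      using pres g Fg unfolding preserves_monos_def in_hom_def by metis
    \<comment> \<open>\<open>v\<close> is the right factor of the mono
      \<open>\<psi> v = F(g)\<close>.\<close>
    then show ?thesis
      using X.mono_arr_Comp_right[OF v' \<psi>(1)] by simp
  qed
  moreover have "mono_arr X (on_Arr F m)"
    using pres m m_arr by (simp add: preserves_monos_def essential_mono_def)
  ultimately show ?thesis
    unfolding essential_mono_def by blast
qed

text \<open>If \<open>f m\<close> is mono, preservation makes \<open>F(f) F(m)\<close> mono;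
  essentiality of \<open>F(m)\<close> then gives \<open>F(f)\<close> mono, and reflection brings
  this back to \<open>f\<close>.\<close>

lemma (in cat_functor) essential_mono_if_on_Arr:
  assumes pres: "preserves_monos C X F" and refl: "reflects_monos C X F"
    and m: "m \<in> Arr C" and Fm: "essential_mono X (on_Arr F m)"
  shows "essential_mono C m"
proof -
  have m_hom: "in_hom C m (Dom C m) (Cod C m)"
    using m by (simp add: in_hom_def)
  have "mono_arr C f"
    if f: "in_hom C f (Cod C m) B" and mono: "mono_arr C (f \<cdot>\<^bsub>C\<^esub> m)" for f B
  proof -
    have "mono_arr X (on_Arr F f \<cdot>\<^bsub>X\<^esub> on_Arr F m)"
      using pres mono on_Arr_Comp[OF m_hom f] unfolding preserves_monos_def mono_arr_def by metis
    moreover have "in_hom X (on_Arr F f) (Cod X (on_Arr F m)) (on_Obj F B)"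
      using on_Arr_in_hom[OF f] on_Arr_in_hom[OF m_hom] by (simp add: in_hom_def)
    ultimately have "mono_arr X (on_Arr F f)"
      using Fm unfolding essential_mono_def by blast
    then show ?thesis
      using refl f by (simp add: reflects_monos_def in_hom_def)
  qed
  moreover have "mono_arr C m"
    using refl m Fm by (simp add: reflects_monos_def essential_mono_def)
  ultimately show ?thesis
    unfolding essential_mono_def by blast
qed

theorem theorem2p5:
  fixes C :: "('o, 'a) cat" and X :: "('p, 'b) cat"
    and F :: "('o, 'a, 'p, 'b) cat_map" and m :: 'a
  assumes "category C" and "category X"
    and "has_finite_limits C" and "has_finite_colimits C"
    and "has_finite_limits X" and "has_finite_colimits X"
    and "weak_opfibration C X F"
    and "preserves_monos C X F" and "reflects_monos C X F"
    and "m \<in> Arr C"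
  shows "essential_mono C m \<longleftrightarrow> essential_mono X (on_Arr F m)"
proof
  show "essential_mono X (on_Arr F m)" if "essential_mono C m"
    using essential_mono_on_Arr[OF assms(7-9) that] .
  have "cat_functor C X F"
    using assms(7) by (simp add: weak_opfibration_def)
  then show "essential_mono C m" if "essential_mono X (on_Arr F m)"
    using cat_functor.essential_mono_if_on_Arr[OF _ assms(8-10) that] by blast
qed

end
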